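(* Let $K=4$ and let $M$ be an integer with $1\le M\le 15$. Index antennas by $\{1,\dots,4M\}$ and let $I_i=\{(i-1)M+1,\dots,iM\}$ for $i=1,\dots,4$. For generic $H,U,W\in\mathbb{C}^{4M\times 4M}$ (that is, outside the zero set of some nonzero polynomial in their entries), there exist block diagonal matrices $D_1,D_2,D_3\in\mathbb{C}^{4M\times 4M}$ with diagonal blocks of size $M\times M$ (block $i$ indexed by $I_i$) and scalars $\lambda_1,\dots,\lambda_{4M}\in\mathbb{C}$ such that, with $B:=HD_1+HD_2U+WD_3H$: for every $i$ and every $m\in I_i$, $B_{mj}=\lambda_m H_{mj}$ for all $j\notin I_i$; and for every $i$, the $M\times M$ matrix $\big(B_{mm'}-\lambda_m H_{mm'}\big)_{m,m'\in I_i}$ is nonsingular.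
   Context: Setting: a 4-user MIMO interference channel with full-duplex in-band interaction, each source and destination having $M$ antennas; antennas of user $i$ are indexed by $I_i$. $H$ is the channel matrix from source antennas to destination antennas, $U$ among source antennas, $W$ among destination antennas. In a two-phase scheme sources send $x$ (receiving $Ux$ while destinations receive $Hx$), then sources send $D_1x+D_2Ux$ and destinations send $D_3Hx$, so destinations receive $Bx$ (noise ignored). The conditions imply each destination can cancel all interference and recover its $M$ desired symbols, giving $2M$ sum degrees of freedom. *)

theory Defs
  imports "Jordan_Normal_Form.Determinant"
begin

text \<open>Polynomial functions in the entries of three n x n complex matrices H, U, W
  (entries indexed 0..n-1). Over the infinite field C, a polynomial is nonzero iff
  its polynomial function is not identically zero.\<close>
inductive matpoly :: "nat \<Rightarrow> (complex mat \<Rightarrow> complex mat \<Rightarrow> complex mat \<Rightarrow> complex) \<Rightarrow> bool"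
  for n :: nat where
  const: "matpoly n (\<lambda>H U W. c)"
| varH: "i < n \<Longrightarrow> j < n \<Longrightarrow> matpoly n (\<lambda>H U W. H $$ (i, j))"
| varU: "i < n \<Longrightarrow> j < n \<Longrightarrow> matpoly n (\<lambda>H U W. U $$ (i, j))"
| varW: "i < n \<Longrightarrow> j < n \<Longrightarrow> matpoly n (\<lambda>H U W. W $$ (i, j))"
| add: "matpoly n p \<Longrightarrow> matpoly n q \<Longrightarrow> matpoly n (\<lambda>H U W. p H U W + q H U W)"
| mult: "matpoly n p \<Longrightarrow> matpoly n q \<Longrightarrow> matpoly n (\<lambda>H U W. p H U W * q H U W)"

text \<open>Block-diagonal with M x M blocks (0-indexed: antenna a belongs to block a div M).\<close>
definition block_diag :: "nat \<Rightarrow> complex mat \<Rightarrow> bool" where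
  "block_diag M D \<longleftrightarrow> (\<forall>a < dim_row D. \<forall>b < dim_col D. a div M \<noteq> b div M \<longrightarrow> D $$ (a, b) = 0)"

definition good :: "nat \<Rightarrow> complex mat \<Rightarrow> complex mat \<Rightarrow> complex mat \<Rightarrow> bool" where
  "good M H U W \<longleftrightarrow>
    (\<exists>D1 D2 D3 (lam :: nat \<Rightarrow> complex).
       D1 \<in> carrier_mat (4*M) (4*M) \<and> D2 \<in> carrier_mat (4*M) (4*M) \<and> D3 \<in> carrier_mat (4*M) (4*M) \<and>
       block_diag M D1 \<and> block_diag M D2 \<and> block_diag M D3 \<and>
       (let B = H * D1 + H * D2 * U + W * D3 * H in
         (\<forall>m < 4*M. \<forall>j < 4*M. j div M \<noteq> m div M \<longrightarrow> B $$ (m, j) = lam m * H $$ (m, j)) \<and>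
         (\<forall>i < 4. det (mat M M (\<lambda>(a, b). B $$ (i*M + a, i*M + b) - lam (i*M + a) * H $$ (i*M + a, i*M + b))) \<noteq> 0)))"

end

theory Submission
  imports Defs
begin

text \<open>For prescribed scalars the interference conditions are a linear system in D1, D2, D3 with as
  many equations as unknowns, namely 12 M^2. By Cramer's rule its determinant d and the numerators
  of its solution are polynomial in H, U, W, so the product of d with the four determinants of the
  numerators of the diagonal blocks is a polynomial whose nonvanishing suffices. It is nonzero at
  H = h \<otimes> 1, U = u \<otimes> 1, W = w \<otimes> 1 for a suitable single-antenna channel h, u, w: there the system
  splits into M^2 copies of the nonsingular 12 x 12 system for M = 1.\<close>

lemma sum_lessThan_3: "(\<Sum>t<(3::nat). f t) = f 0 + f 1 + (f 2 :: 'a::comm_monoid_add)"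
  by (simp add: eval_nat_numeral)

lemma sum_lessThan_4: "(\<Sum>t<(4::nat). f t) = f 0 + f 1 + f 2 + (f 3 :: 'a::comm_monoid_add)"
  by (simp add: eval_nat_numeral)

section \<open>Closure properties of polynomial functions\<close>

lemma matpoly_sum:
  assumes "finite A" and "\<And>i. i \<in> A \<Longrightarrow> matpoly n (f i)"
  shows "matpoly n (\<lambda>H U W. \<Sum>i\<in>A. f i H U W)"
  using assms by (induction A rule: finite_induct) (auto intro: matpoly.intros)

lemma matpoly_prod:
  assumes "finite A" and "\<And>i. i \<in> A \<Longrightarrow> matpoly n (f i)"
  shows "matpoly n (\<lambda>H U W. \<Prod>i\<in>A. f i H U W)"
  using assms by (induction A rule: finite_induct) (auto intro: matpoly.intros)

lemma matpoly_diff: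
  assumes "matpoly n p" and "matpoly n q"
  shows "matpoly n (\<lambda>H U W. p H U W - q H U W)"
proof -
  have "matpoly n (\<lambda>H U W. p H U W + (-1) * q H U W)"
    by (intro matpoly.intros assms)
  then show ?thesis by simp
qed

text \<open>The Leibniz formula builds the determinant from its entries by sums and
  products.\<close>

lemma matpoly_det:
  assumes "\<And>i j. i < k \<Longrightarrow> j < k \<Longrightarrow> matpoly n (f i j)"
  shows "matpoly n (\<lambda>H U W. det (mat k k (\<lambda>(i, j). f i j H U W)))"
proof -
  have "det (mat k k (\<lambda>(i, j). f i j H U W)) =
      (\<Sum>\<pi> | \<pi> permutes {0..<k}. signof \<pi> * (\<Prod>i = 0..<k. f i (\<pi> i) H U W))" for H U W
    by (auto simp: det_def intro!: sum.cong prod.cong)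
  moreover have "matpoly n (\<lambda>H U W. \<Sum>\<pi> | \<pi> permutes {0..<k}.
      signof \<pi> * (\<Prod>i = 0..<k. f i (\<pi> i) H U W))"
    by (intro matpoly_sum matpoly_prod matpoly.mult matpoly.const)
      (auto simp: finite_permutations intro!: assms dest: permutes_in_image)
  ultimately show ?thesis by simp
qed

lemma matpoly_adj_mat:
  assumes "\<And>i j. i < k \<Longrightarrow> j < k \<Longrightarrow> matpoly n (f i j)" and "i < k" and "j < k"
  shows "matpoly n (\<lambda>H U W. adj_mat (mat k k (\<lambda>(i, j). f i j H U W)) $$ (i, j))"
proof -
  \<comment> \<open>\<open>s r\<close> enumerates the indices other than \<open>r\<close> in
    increasing order. The adjugate is the transposed cofactor matrix, so row \<open>j\<close> and
    column \<open>i\<close> are the deleted ones.\<close>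
  define s :: "nat \<Rightarrow> nat \<Rightarrow> nat" where "s = (\<lambda>r a. if a < r then a else Suc a)"
  have "adj_mat (mat k k (\<lambda>(i, j). f i j H U W)) $$ (i, j) =
      (-1)^(j + i) * det (mat (k - 1) (k - 1) (\<lambda>(a, b). f (s j a) (s i b) H U W))" for H U W
    using assms(2,3)
    by (auto simp: adj_mat_def cofactor_def mat_delete_def s_def intro!: arg_cong[where f = det] eq_matI)
  moreover have "matpoly n (\<lambda>H U W.
      (-1)^(j + i) * det (mat (k - 1) (k - 1) (\<lambda>(a, b). f (s j a) (s i b) H U W)))"
    by (intro matpoly.mult matpoly.const matpoly_det assms(1)) (auto simp: s_def)
  ultimately show ?thesis by simp
qed

text \<open>Cramer's rule with the denominator d cleared, so that the identity also holds where d = 0.\<close>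

lemma matpoly_linear_system:
  fixes C :: "'e \<Rightarrow> 'v \<Rightarrow> complex mat \<Rightarrow> complex mat \<Rightarrow> complex mat \<Rightarrow> complex"
  assumes fin: "finite E" "finite V" and card: "card E = card V"
    and C: "\<And>e v. e \<in> E \<Longrightarrow> v \<in> V \<Longrightarrow> matpoly n (C e v)"
    and b: "\<And>e. e \<in> E \<Longrightarrow> matpoly n (b e)"
  shows "\<exists>d y. matpoly n d \<and> (\<forall>v\<in>V. matpoly n (y v)) \<and>
    (\<forall>H U W. \<forall>e\<in>E. (\<Sum>v\<in>V. C e v H U W * y v H U W) = d H U W * b e H U W) \<and>
    (\<forall>H U W. (\<forall>x. (\<forall>e\<in>E. (\<Sum>v\<in>V. C e v H U W * x v) = 0) \<longrightarrow> (\<forall>v\<in>V. x v = 0)) \<longrightarrow>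
      d H U W \<noteq> 0)"
proof -
  define N where "N = card V"
  obtain e where e: "bij_betw e {0..<N} E"
    using ex_bij_betw_nat_finite[OF fin(1)] card by (auto simp: N_def)
  obtain v where v: "bij_betw v {0..<N} V"
    using ex_bij_betw_nat_finite[OF fin(2)] by (auto simp: N_def)
  have eE: "e r \<in> E" if "r < N" for r using e that by (auto simp: bij_betw_def)
  have vV: "v r \<in> V" if "r < N" for r using v that by (auto simp: bij_betw_def)
  define A where "A = (\<lambda>H U W. mat N N (\<lambda>(r, c). C (e r) (v c) H U W))"
  have A: "A H U W \<in> carrier_mat N N" for H U W by (simp add: A_def)
  define B where "B = (\<lambda>H U W. vec N (\<lambda>r. b (e r) H U W))"
  define idx where "idx = the_inv_into {0..<N} v"
  have idx: "idx (v c) = c" if "c < N" for c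
    using that v by (simp add: idx_def bij_betw_def the_inv_into_f_f)
  have idxN: "idx w < N" if "w \<in> V" for w
    using bij_betwE[OF bij_betw_the_inv_into[OF v]] that by (auto simp: idx_def)
  define y where "y = (\<lambda>w H U W. \<Sum>s = 0..<N. adj_mat (A H U W) $$ (idx w, s) * b (e s) H U W)"
  define d where "d = (\<lambda>H U W. det (A H U W))"
  have row: "(\<Sum>w\<in>V. C (e r) w H U W * x w) = (A H U W *\<^sub>v vec N (\<lambda>c. x (v c))) $ r"
    if "r < N" for H U W x r
    using that unfolding sum.reindex_bij_betw[OF v, symmetric]
    by (simp add: A_def scalar_prod_def)
  show ?thesis
  proof (rule exI[of _ d], rule exI[of _ y], intro conjI allI ballI impI)
    show "matpoly n d"
      unfolding d_def A_def by (intro matpoly_det C eE vV)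
    show "matpoly n (y w)" if "w \<in> V" for w
      unfolding y_def A_def using that
      by (intro matpoly_sum matpoly.mult matpoly_adj_mat C b eE vV idxN) auto
    show "(\<Sum>w\<in>V. C f w H U W * y w H U W) = d H U W * b f H U W" if f: "f \<in> E" for H U W f
    proof -
      obtain r where r: "r < N" "f = e r" using e f by (auto simp: bij_betw_def)
      have adj: "adj_mat (A H U W) \<in> carrier_mat N N" by (rule adj_mat(1)[OF A])
      have "vec N (\<lambda>c. y (v c) H U W) = adj_mat (A H U W) *\<^sub>v B H U W"
        using adj by (auto simp: y_def B_def idx scalar_prod_def intro!: sum.cong)
      then have "A H U W *\<^sub>v vec N (\<lambda>c. y (v c) H U W) = (A H U W * adj_mat (A H U W)) *\<^sub>v B H U W"
        using assoc_mult_mat_vec[OF A adj, of "B H U W"] by (simp add: B_def)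
      \<comment> \<open>A matrix times its adjugate is its determinant times the identity, whether
        or not it is invertible.\<close>
      also have "\<dots> = d H U W \<cdot>\<^sub>v B H U W"
        unfolding adj_mat(2)[OF A] d_def
        by (rule eq_vecI) (auto simp: B_def scalar_prod_def if_distrib[where f = "(*) _"]
              if_distrib[where f = "\<lambda>c. c * _"] cong: if_cong)
      finally show ?thesis using r by (simp add: row B_def)
    qed
    show "d H U W \<noteq> 0"
      if ker: "\<forall>x. (\<forall>f\<in>E. (\<Sum>w\<in>V. C f w H U W * x w) = 0) \<longrightarrow> (\<forall>w\<in>V. x w = 0)" for H U W
    proof
      assume "d H U W = 0"
      \<comment> \<open>A singular matrix has a nonzero kernel vector; read through
        \<open>idx\<close>, it is a nonzero solution of the homogeneous system.\<close>
      then obtain z where z: "z \<in> carrier_vec N" "z \<noteq> 0\<^sub>v N" "A H U W *\<^sub>v z = 0\<^sub>v N"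
        using det_0_iff_vec_prod_zero[OF A] by (auto simp: d_def)
      have zz: "vec N (\<lambda>c. z $ idx (v c)) = z"
        using z(1) by (auto simp: idx)
      have "(\<Sum>w\<in>V. C f w H U W * z $ idx w) = 0" if f: "f \<in> E" for f
      proof -
        obtain r where "r < N" "f = e r" using e f by (auto simp: bij_betw_def)
        then show ?thesis using z(3) by (simp add: row zz)
      qed
      then have "z $ idx w = 0" if "w \<in> V" for w
        using ker[THEN spec, of "\<lambda>w. z $ idx w"] that by blast
      then have "z $ c = 0" if "c < N" for c
        using that vV idx by metis
      then show False using z(1,2) by (auto intro!: eq_vecI)
    qed
  qed
qed

section \<open>Index sets of the unknowns and of the equations\<close>

definition diag_idx :: "nat \<Rightarrow> (nat \<times> nat) set" where
  "diag_idx M = {(a, b). a < 4*M \<and> b < 4*M \<and> a div M = b div M}"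

text \<open>Each position carries one interference equation, whereas \<open>diag_idx\<close> indexes
  the free entries of one block diagonal matrix.\<close>

definition off_idx :: "nat \<Rightarrow> (nat \<times> nat) set" where
  "off_idx M = {(m, j). m < 4*M \<and> j < 4*M \<and> j div M \<noteq> m div M}"

lemma finite_idx: "finite (diag_idx M)" "finite (off_idx M)"
  by (rule finite_subset[of _ "{..<4*M} \<times> {..<4*M}"]; auto simp: diag_idx_def off_idx_def)+

lemma block_index_less:
  fixes k M r n :: nat
  assumes "k < n" and "r < M"
  shows "k*M + r < n*M"
proof -
  have "k*M + r < (k + 1)*M" using assms by simp
  also have "\<dots> \<le> n*M" using assms by (intro mult_right_mono) auto
  finally show ?thesis .
qed

lemma card_diag_idx:
  assumes "0 < M"
  shows "card (diag_idx M) = 4 * M * M"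
proof -
  \<comment> \<open>In a fixed row the admissible columns form an interval of length M.\<close>
  have "diag_idx M = Sigma {..<4*M} (\<lambda>a. {a div M * M..<a div M * M + M})"
  proof -
    have "b < 4*M \<and> a div M = b div M \<longleftrightarrow> b \<in> {a div M * M..<a div M * M + M}" if "a < 4*M" for a b
    proof
      assume "b < 4*M \<and> a div M = b div M"
      then show "b \<in> {a div M * M..<a div M * M + M}"
        using assms div_mult_mod_eq[of b M] mod_less_divisor[of M b]
        by (metis add_less_cancel_left atLeastLessThan_iff div_mult_mod_eq le_add1)
    next
      assume *: "b \<in> {a div M * M..<a div M * M + M}"
      then have "b div M = a div M"
        using assms by (intro div_nat_eqI) (auto simp: algebra_simps)
      moreover have "a div M < 4" using that assms by (simp add: less_mult_imp_div_less)
      ultimately show "b < 4*M \<and> a div M = b div M"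
        using assms by (metis div_less_iff_less_mult)
    qed
    then show ?thesis unfolding diag_idx_def by blast
  qed
  then show ?thesis by simp
qed

text \<open>This makes the system square: (4M)^2 - 4M^2 = 3 * 4M^2. With K users there would be
  K(K-1)M^2 equations in 3KM^2 unknowns, and for positive K these numbers agree only at K =
  4.\<close>

lemma card_off_idx:
  assumes "0 < M"
  shows "card (off_idx M) = card ({..<3::nat} \<times> diag_idx M)"
proof -
  have "off_idx M = {..<4*M} \<times> {..<4*M} - diag_idx M"
    by (auto simp: diag_idx_def off_idx_def)
  moreover have "diag_idx M \<subseteq> {..<4*M} \<times> {..<4*M}"
    by (auto simp: diag_idx_def)
  ultimately have "card (off_idx M) = card ({..<4*M} \<times> {..<4*M}) - card (diag_idx M)"
    using finite_idx by (simp add: card_Diff_subset)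
  then show ?thesis by (simp add: card_diag_idx[OF assms] card_cartesian_product)
qed

section \<open>The interference conditions as a linear system\<close>

text \<open>All three terms of B have the shape X D Y, with (X, Y) = (H, 1), (H, U), (W, H); the unknown
  indexed by (t, a, b) is entry (a, b) of the matrix D in term t.\<close>

definition coef ::
  "nat \<Rightarrow> nat \<Rightarrow> nat \<Rightarrow> nat \<times> nat \<times> nat \<Rightarrow> complex mat \<Rightarrow> complex mat \<Rightarrow> complex mat \<Rightarrow> complex"
  where
  "coef M m j = (\<lambda>(t, a, b) H U W. (if t = 2 then W else H) $$ (m, a) *
     (if t = 0 then 1\<^sub>m (4*M) else if t = 1 then U else H) $$ (b, j))"

definition blk_mat :: "nat \<Rightarrow> (nat \<times> nat \<Rightarrow> complex) \<Rightarrow> complex mat" where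
  "blk_mat M x = mat (4*M) (4*M) (\<lambda>(a, b). if a div M = b div M then x (a, b) else 0)"

lemma blk_mat_carrier [simp]: "blk_mat M x \<in> carrier_mat (4*M) (4*M)"
  by (simp add: blk_mat_def)

lemma matpoly_coef:
  assumes "m < 4*M" "j < 4*M" "v \<in> {..<3} \<times> diag_idx M"
  shows "matpoly (4*M) (coef M m j v)"
proof -
  obtain t a b where v: "v = (t, a, b)" by (cases v)
  have ab: "a < 4*M" "b < 4*M" using assms(3) by (auto simp: v diag_idx_def)
  have "matpoly (4*M) (\<lambda>H U W. (if t = 2 then W else H) $$ (m, a))"
    by (cases "t = 2") (simp_all add: matpoly.intros assms ab)
  moreover have "matpoly (4*M)
      (\<lambda>H U W. (if t = 0 then 1\<^sub>m (4*M) else if t = 1 then U else H) $$ (b, j))"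
    by (cases "t = 0"; cases "t = 1") (simp_all add: matpoly.intros assms ab)
  ultimately show ?thesis by (simp add: v coef_def matpoly.mult)
qed

text \<open>A product X D Y is linear in D; restricting the double sum to \<open>diag_idx\<close>
  drops the entries that are zero by block diagonality.\<close>

lemma sandwich_entry:
  assumes X: "X \<in> carrier_mat (4*M) (4*M)" and Y: "Y \<in> carrier_mat (4*M) (4*M)"
    and mj: "m < 4*M" "j < 4*M"
  shows "(X * blk_mat M x * Y) $$ (m, j) =
    (\<Sum>(a, b)\<in>diag_idx M. X $$ (m, a) * Y $$ (b, j) * x (a, b))"
proof -
  have "(X * blk_mat M x * Y) $$ (m, j) =
      (\<Sum>b<4*M. (\<Sum>a<4*M. X $$ (m, a) * (if a div M = b div M then x (a, b) else 0)) * Y $$ (b, j))"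
    using X Y mj by (auto simp: scalar_prod_def blk_mat_def atLeast0LessThan intro!: sum.cong)
  also have "\<dots> = (\<Sum>a<4*M. \<Sum>b<4*M.
      X $$ (m, a) * Y $$ (b, j) * (if a div M = b div M then x (a, b) else 0))"
    by (subst sum.swap) (simp add: sum_distrib_left sum_distrib_right mult_ac)
  also have "\<dots> = (\<Sum>(a, b)\<in>{..<4*M} \<times> {..<4*M}.
      X $$ (m, a) * Y $$ (b, j) * (if a div M = b div M then x (a, b) else 0))"
    by (simp add: sum.cartesian_product)
  also have "\<dots> = (\<Sum>(a, b)\<in>diag_idx M. X $$ (m, a) * Y $$ (b, j) * x (a, b))"
    by (rule sum.mono_neutral_cong_right) (auto simp: diag_idx_def split: if_splits)
  finally show ?thesis .
qed

lemma received_entry: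
  assumes H: "H \<in> carrier_mat (4*M) (4*M)" and U: "U \<in> carrier_mat (4*M) (4*M)"
    and W: "W \<in> carrier_mat (4*M) (4*M)" and mj: "m < 4*M" "j < 4*M"
  shows "(H * blk_mat M (\<lambda>p. x (0, p)) + H * blk_mat M (\<lambda>p. x (1, p)) * U
      + W * blk_mat M (\<lambda>p. x (2, p)) * H) $$ (m, j) =
    (\<Sum>v\<in>{..<3} \<times> diag_idx M. coef M m j v H U W * x v)"
proof -
  \<comment> \<open>The identity supplies the right factor that the first term lacks.\<close>
  have 1: "H * blk_mat M (\<lambda>p. x (0, p)) = H * blk_mat M (\<lambda>p. x (0, p)) * 1\<^sub>m (4*M)"
    by (rule right_mult_one_mat[OF mult_carrier_mat[OF H blk_mat_carrier], symmetric])
  have 2: "(H * blk_mat M (\<lambda>p. x (0, p)) + H * blk_mat M (\<lambda>p. x (1, p)) * U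
      + W * blk_mat M (\<lambda>p. x (2, p)) * H) $$ (m, j) =
      (H * blk_mat M (\<lambda>p. x (0, p)) * 1\<^sub>m (4*M)) $$ (m, j) +
      (H * blk_mat M (\<lambda>p. x (1, p)) * U) $$ (m, j) + (W * blk_mat M (\<lambda>p. x (2, p)) * H) $$ (m, j)"
    using H U W mj by (subst 1) simp
  show ?thesis
    unfolding 2 sandwich_entry[OF H one_carrier_mat mj] sandwich_entry[OF H U mj]
      sandwich_entry[OF W H mj]
    by (simp add: sum.cartesian_product' sum_lessThan_3 coef_def case_prod_unfold)
qed

section \<open>The witness channel and its trivial kernel\<close>

text \<open>The supports of a (0, 1)-channel for single antennas (M = 1), found by computer search so
  that the interference equations in D1, D2, D3 form a nearly triangular 12 x 12 system.\<close>

definition suppH :: "(nat \<times> nat) set" where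
  "suppH = {(0,0), (0,1), (0,3), (1,1), (2,0), (2,2), (3,2), (3,3)}"
definition suppU :: "(nat \<times> nat) set" where
  "suppU = {(0,2), (1,0), (2,1), (3,0)}"
definition suppW :: "(nat \<times> nat) set" where
  "suppW = {(1,0), (1,1), (1,2), (2,1), (2,3)}"

text \<open>Supports of the left factor X and, in \<open>suppR\<close>, of the right factor Y in
  term \<open>t\<close>.\<close>

definition suppL :: "nat \<Rightarrow> (nat \<times> nat) set" where
  "suppL t = (if t = 2 then suppW else suppH)"
definition suppR :: "nat \<Rightarrow> (nat \<times> nat) set" where
  "suppR t = (if t = 0 then Id else if t = 1 then suppU else suppH)"

text \<open>The Kronecker product with the identity of size M: the antennas with a given index
  modulo M then form M independent copies of the single-antenna channel.\<close>

definition kron_id :: "nat \<Rightarrow> (nat \<times> nat) set \<Rightarrow> complex mat" where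
  "kron_id M S = mat (4*M) (4*M) (\<lambda>(i, j). of_bool (i mod M = j mod M \<and> (i div M, j div M) \<in> S))"

lemma kron_id_carrier [simp]: "kron_id M S \<in> carrier_mat (4*M) (4*M)"
  by (simp add: kron_id_def)

lemma one_mat_kron_id: "1\<^sub>m (4*M) = kron_id M Id"
  by (rule eq_matI) (auto simp: kron_id_def one_mat_def, metis div_mult_mod_eq)

text \<open>Here \<open>z t k\<close> is diagonal entry \<open>k\<close> of the matrix D in term
  \<open>t\<close>. Ten equations contain a single unknown each; those at (1,0) and (2,1) each add
  one new unknown to unknowns already known to vanish.\<close>

lemma single_antenna_kernel:
  fixes z :: "nat \<Rightarrow> nat \<Rightarrow> complex"
  assumes "\<And>i j. i < 4 \<Longrightarrow> j < 4 \<Longrightarrow> i \<noteq> j \<Longrightarrow>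
      (\<Sum>t<3. \<Sum>k<4. of_bool ((i, k) \<in> suppL t \<and> (k, j) \<in> suppR t) * z t k) = 0"
    and "t < 3" "k < 4"
  shows "z t k = 0"
proof -
  note simps = suppL_def suppR_def suppH_def suppU_def suppW_def sum_lessThan_3 sum_lessThan_4
  have z01: "z 0 1 = 0" using assms(1)[of 0 1] by (simp add: simps)
  have z10: "z 1 0 = 0" using assms(1)[of 0 2] by (simp add: simps)
  have z03: "z 0 3 = 0" using assms(1)[of 0 3] by (simp add: simps)
  have z22: "z 2 2 = 0" using assms(1)[of 1 2] by (simp add: simps)
  have z20: "z 2 0 = 0" using assms(1)[of 1 3] by (simp add: simps)
  have z00: "z 0 0 = 0" using assms(1)[of 2 0] by (simp add: simps)
  have z23: "z 2 3 = 0" using assms(1)[of 2 3] by (simp add: simps)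
  have z13: "z 1 3 = 0" using assms(1)[of 3 0] by (simp add: simps)
  have z12: "z 1 2 = 0" using assms(1)[of 3 1] by (simp add: simps)
  have z02: "z 0 2 = 0" using assms(1)[of 3 2] by (simp add: simps)
  have "z 1 1 + z 2 0 + z 2 2 = 0" using assms(1)[of 1 0] by (simp add: simps add_ac)
  then have z11: "z 1 1 = 0" by (simp only: z20 z22 add_0_right)
  have "z 1 2 + z 2 1 = 0" using assms(1)[of 2 1] by (simp add: simps)
  then have z21: "z 2 1 = 0" by (simp only: z12 add_0_left)
  have z: "\<forall>t\<in>{0, 1, 2}. \<forall>k\<in>{0, 1, 2, 3}. z t k = 0"
    by (simp only: ball_simps simp_thms z00 z01 z02 z03 z10 z11 z12 z13 z20 z21 z22 z23)
  have tk: "t \<in> {0, 1, 2}" "k \<in> {0, 1, 2, 3}"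
    using assms(2,3) by auto
  show ?thesis by (rule z[rule_format, OF tk])
qed

abbreviation "wH M \<equiv> kron_id M suppH"
abbreviation "wU M \<equiv> kron_id M suppU"
abbreviation "wW M \<equiv> kron_id M suppW"

lemma coef_kron_id:
  assumes "m < 4*M" "j < 4*M" "(a, b) \<in> diag_idx M"
  shows "coef M m j (t, a, b) (wH M) (wU M) (wW M) =
    of_bool (m mod M = a mod M \<and> (m div M, a div M) \<in> suppL t) *
    of_bool (b mod M = j mod M \<and> (b div M, j div M) \<in> suppR t)"
  using assms unfolding coef_def one_mat_kron_id
  by (auto simp: kron_id_def suppL_def suppR_def diag_idx_def)

text \<open>The coefficient of the unknown at (a, b) vanishes unless a agrees with \<open>m\<close>
  and b with \<open>j\<close> modulo M. Given these residues, an unknown is determined by its term t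
  and block k, so the system splits according to pairs of residues.\<close>

lemma coef_sum_kron_id:
  assumes M: "0 < M" and mj: "m < 4*M" "j < 4*M"
  shows "(\<Sum>v\<in>{..<3} \<times> diag_idx M. coef M m j v (wH M) (wU M) (wW M) * x v) =
    (\<Sum>t<3. \<Sum>k<4. of_bool ((m div M, k) \<in> suppL t \<and> (k, j div M) \<in> suppR t) *
      x (t, k*M + m mod M, k*M + j mod M))"
proof -
  define g where "g = (\<lambda>(t::nat, k). (t, k*M + m mod M, k*M + j mod M))"
  have r: "m mod M < M" "j mod M < M" using M by auto
  note lt = block_index_less
  have sub: "g ` ({..<3} \<times> {..<4}) \<subseteq> {..<3} \<times> diag_idx M"
    using r M by (auto simp: g_def diag_idx_def lt)
  have inj: "inj_on g ({..<3} \<times> {..<4})"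
    using M by (auto simp: inj_on_def g_def)
  have zero: "coef M m j v (wH M) (wU M) (wW M) * x v = 0"
    if v: "v \<in> {..<3} \<times> diag_idx M - g ` ({..<3} \<times> {..<4})" for v
  proof -
    obtain t a b where tab: "v = (t, a, b)" by (cases v)
    then have ab: "(a, b) \<in> diag_idx M" "t < 3" using v by auto
    then have k: "a div M < 4" "a div M = b div M" "a < 4*M"
      using M by (auto simp: diag_idx_def less_mult_imp_div_less)
    have "\<not> (a mod M = m mod M \<and> b mod M = j mod M)"
    proof
      assume "a mod M = m mod M \<and> b mod M = j mod M"
      then have "v = g (t, a div M)"
        using k(2) by (simp add: tab g_def) (metis div_mult_mod_eq)
      then show False using v ab(2) k(1) by auto
    qed
    then show ?thesis using coef_kron_id[OF mj ab(1)] by (auto simp: tab)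
  qed
  have "(\<Sum>v\<in>{..<3} \<times> diag_idx M. coef M m j v (wH M) (wU M) (wW M) * x v) =
      (\<Sum>v\<in>g ` ({..<3} \<times> {..<4}). coef M m j v (wH M) (wU M) (wW M) * x v)"
    using zero sub by (intro sum.mono_neutral_right) (auto simp: finite_idx)
  also have "\<dots> = (\<Sum>q\<in>{..<3} \<times> {..<4}. coef M m j (g q) (wH M) (wU M) (wW M) * x (g q))"
    using inj by (simp add: sum.reindex)
  also have "\<dots> = (\<Sum>(t, k)\<in>{..<3} \<times> {..<4}.
      of_bool ((m div M, k) \<in> suppL t \<and> (k, j div M) \<in> suppR t) * x (t, k*M + m mod M, k*M + j mod M))"
  proof (rule sum.cong[OF refl], clarify)
    fix t k :: nat
    assume "t < 3" "k < 4"
    then have "(k*M + m mod M, k*M + j mod M) \<in> diag_idx M"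
      using sub by (force simp: g_def)
    then show "coef M m j (g (t, k)) (wH M) (wU M) (wW M) * x (g (t, k)) =
        of_bool ((m div M, k) \<in> suppL t \<and> (k, j div M) \<in> suppR t) * x (t, k*M + m mod M, k*M + j mod M)"
      using M by (simp add: g_def coef_kron_id[OF mj])
  qed
  finally show ?thesis by (simp only: sum.cartesian_product)
qed

text \<open>If r and s are the residues of the row and column of the unknown, the twelve equations
  at (i*M + r, j*M + s) with distinct i, j form a copy of the single-antenna system.\<close>

lemma kron_id_kernel:
  assumes M: "0 < M"
    and eq: "\<And>e. e \<in> off_idx M \<Longrightarrow>
      (\<Sum>v\<in>{..<3} \<times> diag_idx M. coef M (fst e) (snd e) v (wH M) (wU M) (wW M) * x v) = 0"
    and v: "v \<in> {..<3} \<times> diag_idx M"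
  shows "x v = 0"
proof -
  obtain t a b where tab: "v = (t, a, b)" by (cases v)
  define r s where "r = a mod M" and "s = b mod M"
  have rs: "r < M" "s < M" using M by (auto simp: r_def s_def)
  define z where "z = (\<lambda>t k. x (t, k*M + r, k*M + s))"
  note lt = block_index_less
  have eqs: "(\<Sum>t<3. \<Sum>k<4. of_bool ((i, k) \<in> suppL t \<and> (k, j) \<in> suppR t) * z t k) = 0"
    if "i < 4" "j < 4" "i \<noteq> j" for i j
  proof -
    have "(i*M + r, j*M + s) \<in> off_idx M"
      using that rs lt by (auto simp: off_idx_def)
    from eq[OF this] show ?thesis
      using that rs by (simp add: coef_sum_kron_id[OF M lt lt] z_def)
  qed
  have tk: "t < 3" "a div M < 4"
    using v M by (auto simp: tab diag_idx_def less_mult_imp_div_less)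
  have "z t (a div M) = 0"
    by (rule single_antenna_kernel[OF _ tk]) (rule eqs)
  moreover have "a div M = b div M" using v by (auto simp: tab diag_idx_def)
  ultimately show ?thesis
    by (simp add: z_def r_def s_def tab) (metis div_mult_mod_eq)
qed

text \<open>At the witness the choice of scalars lamW forces D1 to be diagonal with values gainW,
  and D2 = D3 = 0.\<close>

definition lamW :: "nat \<Rightarrow> complex" where
  "lamW i = (if i = 0 then 0 else if i = 2 then 2 else 1)"
definition gainW :: "nat \<Rightarrow> complex" where
  "gainW i = (if i = 0 then 2 else if i = 2 then 1 else 0)"
definition solW :: "nat \<Rightarrow> nat \<times> nat \<times> nat \<Rightarrow> complex" where
  "solW M = (\<lambda>(t, a, b). if t = 0 \<and> a = b then gainW (a div M) else 0)"

text \<open>With D2 = D3 = 0 and D1 diagonal, the received matrix is H D1, that is, H with its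
  columns scaled.\<close>

lemma solW_received:
  assumes M: "0 < M" and mj: "m < 4*M" "j < 4*M"
  shows "(\<Sum>v\<in>{..<3} \<times> diag_idx M. coef M m j v (wH M) (wU M) (wW M) * solW M v) =
    gainW (j div M) * wH M $$ (m, j)"
proof -
  have j: "j div M < 4" using mj M by (simp add: less_mult_imp_div_less)
  have sol: "solW M (t, k*M + m mod M, k*M + j mod M) =
      (if t = 0 \<and> m mod M = j mod M then gainW k else 0)" for t k
    using M by (simp add: solW_def)
  have "(\<Sum>v\<in>{..<3} \<times> diag_idx M. coef M m j v (wH M) (wU M) (wW M) * solW M v) =
      (\<Sum>k<4. of_bool ((m div M, k) \<in> suppH \<and> k = j div M \<and> m mod M = j mod M) * gainW k)"
    unfolding coef_sum_kron_id[OF M mj] sol sum_lessThan_3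
    by (cases "m mod M = j mod M") (auto simp: suppL_def suppR_def intro!: sum.cong)
  also have "\<dots> = (\<Sum>k<4. if k = j div M
      then gainW k * of_bool (m mod M = j mod M \<and> (m div M, k) \<in> suppH) else 0)"
    by (rule sum.cong) auto
  also have "\<dots> = gainW (j div M) * wH M $$ (m, j)"
    using j mj by (simp add: sum.delta kron_id_def)
  finally show ?thesis .
qed

text \<open>These relations dictate the constants. Off the diagonal \<open>suppH\<close> consists of
  (0,1), (0,3), (2,0), (3,2), so gains 1 and 3 must equal scalar 0, gain 0 scalar 2, and gain 2
  scalar 3. That gain and scalar differ for each user keeps the desired signal alive.\<close>

lemma lamW_gainW:
  assumes "i < 4" "j < 4"
  shows "(i, j) \<in> suppH \<Longrightarrow> i \<noteq> j \<Longrightarrow> gainW j = lamW i" and "gainW i \<noteq> lamW i" and "(i, i) \<in> suppH"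
  using assms by (auto simp: suppH_def gainW_def lamW_def)

theorem theorem6:
  fixes M :: nat
  assumes "1 \<le> M" and "M \<le> 15"
  shows "\<exists>p. matpoly (4*M) p \<and>
           (\<exists>H U W. H \<in> carrier_mat (4*M) (4*M) \<and> U \<in> carrier_mat (4*M) (4*M) \<and>
                    W \<in> carrier_mat (4*M) (4*M) \<and> p H U W \<noteq> 0) \<and>
           (\<forall>H U W. H \<in> carrier_mat (4*M) (4*M) \<longrightarrow> U \<in> carrier_mat (4*M) (4*M) \<longrightarrow>
                    W \<in> carrier_mat (4*M) (4*M) \<longrightarrow> p H U W \<noteq> 0 \<longrightarrow> good M H U W)"
proof -
  have M: "0 < M" using assms(1) by simp
  let ?V = "{..<3::nat} \<times> diag_idx M"
  \<comment> \<open>The scalars are fixed before the channel is given, one per user, so that the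
    conditions stay linear in D1, D2, D3.\<close>
  define lam where "lam m = lamW (m div M)" for m
  have lhs: "matpoly (4*M) (coef M (fst e) (snd e) v)" if "e \<in> off_idx M" "v \<in> ?V" for e v
    using that by (intro matpoly_coef) (auto simp: off_idx_def)
  have rhs: "matpoly (4*M) (\<lambda>H U W. lam (fst e) * H $$ (fst e, snd e))" if "e \<in> off_idx M" for e
    using that by (intro matpoly.intros) (auto simp: off_idx_def)
  have "finite ?V" by (simp add: finite_idx)
  from matpoly_linear_system[where C = "\<lambda>e. coef M (fst e) (snd e)",
      OF finite_idx(2) this card_off_idx[OF M] lhs rhs, of "\<lambda>e. e"]
  obtain d y where
    d: "matpoly (4*M) d" and y: "\<forall>v\<in>?V. matpoly (4*M) (y v)"
    and sol: "\<forall>H U W. \<forall>e\<in>off_idx M. (\<Sum>v\<in>?V. coef M (fst e) (snd e) v H U W * y v H U W) =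
        d H U W * (lam (fst e) * H $$ (fst e, snd e))"
    and d_nz: "\<forall>H U W. (\<forall>x. (\<forall>e\<in>off_idx M.
        (\<Sum>v\<in>?V. coef M (fst e) (snd e) v H U W * x v) = 0) \<longrightarrow> (\<forall>v\<in>?V. x v = 0))
      \<longrightarrow> d H U W \<noteq> 0"
    by blast
  \<comment> \<open>Where \<open>d\<close> is nonzero and B is built from the solution
    \<open>y\<close> / \<open>d\<close>, this is \<open>d\<close> times an entry of diagonal block
    \<open>i\<close> of B minus the scaled H; clearing the denominator makes it polynomial.\<close>
  define blk where "blk i a b H U W =
      (\<Sum>v\<in>?V. coef M (i*M + a) (i*M + b) v H U W * y v H U W) -
      d H U W * (lam (i*M + a) * H $$ (i*M + a, i*M + b))" for i a b H U W
  define p where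
    "p H U W = d H U W * (\<Prod>i<4. det (mat M M (\<lambda>(a, b). blk i a b H U W)))" for H U W
  have lt: "i*M + a < 4*M" if "i < 4" "a < M" for i a by (rule block_index_less[OF that])
  have "matpoly (4*M) (blk i a b)" if "i < 4" "a < M" "b < M" for i a b
    unfolding blk_def using that lt
    by (intro matpoly_diff matpoly_sum matpoly.mult matpoly.const matpoly.varH matpoly_coef y[rule_format] d)
      (auto simp: finite_idx)
  then have p: "matpoly (4*M) p"
    unfolding p_def by (intro matpoly.mult d matpoly_prod matpoly_det) auto
  have witness: "p (wH M) (wU M) (wW M) \<noteq> 0"
  proof -
    let ?d = "d (wH M) (wU M) (wW M)" and ?y = "\<lambda>v. y v (wH M) (wU M) (wW M)"
    let ?c = "\<lambda>m j v. coef M m j v (wH M) (wU M) (wW M)"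
    have d0: "?d \<noteq> 0"
      using d_nz kron_id_kernel[OF M] by blast
    \<comment> \<open>Both sides solve the same inhomogeneous system, so their difference lies in
      the kernel, which is trivial at the witness.\<close>
    have y_eq: "?y v = ?d * solW M v" if v: "v \<in> ?V" for v
    proof -
      have "(\<Sum>v\<in>?V. ?c (fst e) (snd e) v * (?y v - ?d * solW M v)) = 0"
        if e: "e \<in> off_idx M" for e
      proof -
        obtain m j where mj: "e = (m, j)" "m < 4*M" "j < 4*M" "m div M \<noteq> j div M"
          using e by (cases e) (auto simp: off_idx_def)
        have "(\<Sum>v\<in>?V. ?c m j v * (?y v - ?d * solW M v)) =
            (\<Sum>v\<in>?V. ?c m j v * ?y v) - ?d * (\<Sum>v\<in>?V. ?c m j v * solW M v)"
          by (simp add: right_diff_distrib sum_subtractf sum_distrib_left mult_ac)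
        also have "\<dots> = ?d * (lam m * wH M $$ (m, j)) - ?d * (gainW (j div M) * wH M $$ (m, j))"
          using sol[rule_format, OF e] by (simp only: mj fst_conv snd_conv solW_received[OF M mj(2,3)])
        also have "\<dots> = ?d * ((lam m - gainW (j div M)) * wH M $$ (m, j))"
          by (simp add: algebra_simps)
        \<comment> \<open>Between distinct blocks, either the entry of H vanishes or gain and scalar
          agree.\<close>
        also have "\<dots> = 0"
          using lamW_gainW(1)[of "m div M" "j div M"] mj M
          by (auto simp: kron_id_def lam_def less_mult_imp_div_less)
        finally show ?thesis by (simp add: mj)
      qed
      then have "?y v - ?d * solW M v = 0"
        using kron_id_kernel[OF M, of "\<lambda>v. ?y v - ?d * solW M v"] v by blast
      then show ?thesis by simp
    qed
    have "det (mat M M (\<lambda>(a, b). blk i a b (wH M) (wU M) (wW M))) \<noteq> 0" if i: "i < 4" for i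
    proof -
      \<comment> \<open>The diagonal blocks of H at the witness are identity matrices, so the block
        of numerators is a scalar matrix.\<close>
      have "blk i a b (wH M) (wU M) (wW M) =
          (if a = b then ?d * (gainW i - lamW i) else 0)" if ab: "a < M" "b < M" for a b
      proof -
        have "(\<Sum>v\<in>?V. ?c (i*M + a) (i*M + b) v * ?y v) =
            ?d * (\<Sum>v\<in>?V. ?c (i*M + a) (i*M + b) v * solW M v)"
          unfolding sum_distrib_left by (intro sum.cong refl) (simp add: y_eq mult_ac)
        moreover have "wH M $$ (i*M + a, i*M + b) = of_bool (a = b)"
          using i ab lt by (simp add: kron_id_def lamW_gainW(3))
        ultimately show ?thesis
          using i ab unfolding blk_def
          by (simp add: solW_received[OF M lt lt] lam_def right_diff_distrib)
      qed
      then have "mat M M (\<lambda>(a, b). blk i a b (wH M) (wU M) (wW M)) =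
          (?d * (gainW i - lamW i)) \<cdot>\<^sub>m 1\<^sub>m M"
        by (intro eq_matI) auto
      then show ?thesis using d0 lamW_gainW(2)[OF i i] by (simp add: det_smult)
    qed
    then show ?thesis using d0 by (simp add: p_def)
  qed
  have "good M H U W"
    if H: "H \<in> carrier_mat (4*M) (4*M)" and U: "U \<in> carrier_mat (4*M) (4*M)"
      and W: "W \<in> carrier_mat (4*M) (4*M)" and pnz: "p H U W \<noteq> 0" for H U W
  proof -
    have d0: "d H U W \<noteq> 0" using pnz by (simp add: p_def)
    \<comment> \<open>Dividing by \<open>d\<close> turns the cleared identity into an actual
      solution.\<close>
    define x where "x v = y v H U W / d H U W" for v
    define B where "B = H * blk_mat M (\<lambda>p. x (0, p)) + H * blk_mat M (\<lambda>p. x (1, p)) * U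
      + W * blk_mat M (\<lambda>p. x (2, p)) * H"
    have B: "d H U W * B $$ (m, j) = (\<Sum>v\<in>?V. coef M m j v H U W * y v H U W)"
      if "m < 4*M" "j < 4*M" for m j
      unfolding B_def received_entry[OF H U W that] sum_distrib_left
      using d0 by (simp add: x_def)
    have off: "B $$ (m, j) = lam m * H $$ (m, j)"
      if "m < 4*M" "j < 4*M" "j div M \<noteq> m div M" for m j
    proof -
      have "(m, j) \<in> off_idx M" using that by (simp add: off_idx_def)
      from sol[rule_format, OF this, of H U W] show ?thesis using d0 by (simp add: B[symmetric] that)
    qed
    have det: "det (mat M M (\<lambda>(a, b). B $$ (i*M + a, i*M + b) - lam (i*M + a) * H $$ (i*M + a, i*M + b))) \<noteq> 0"
      (is "det ?N \<noteq> 0") if i: "i < 4" for i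
    proof -
      \<comment> \<open>The two determinants differ by a power of \<open>d\<close>, so nonvanishing
        passes from the numerators to \<open>?N\<close>.\<close>
      have "mat M M (\<lambda>(a, b). blk i a b H U W) = d H U W \<cdot>\<^sub>m ?N"
        using i by (intro eq_matI) (simp_all add: blk_def B[OF lt lt, symmetric] right_diff_distrib)
      moreover have "det (mat M M (\<lambda>(a, b). blk i a b H U W)) \<noteq> 0"
        using pnz i by (simp add: p_def)
      ultimately show ?thesis by (auto simp: det_smult)
    qed
    have bd: "block_diag M (blk_mat M f)" for f
      by (auto simp: block_diag_def blk_mat_def)
    show ?thesis
      unfolding good_def Let_def
      by (rule exI[of _ "blk_mat M (\<lambda>p. x (0, p))"], rule exI[of _ "blk_mat M (\<lambda>p. x (1, p))"],
          rule exI[of _ "blk_mat M (\<lambda>p. x (2, p))"], rule exI[of _ lam])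
        (use off det in \<open>simp add: bd B_def\<close>)
  qed
  then show ?thesis
    using p witness kron_id_carrier by blast
qed

end
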